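(* Let $q\ge1$ and let $\{M(t)\}_{t\ge0},\{M_1(t)\}_{t\ge0},\dots,\{M_q(t)\}_{t\ge0}$ be independent generalized counting processes, where $M$ has positive rates $\lambda_j$, $j=1,\dots,k$, and $M_i$ performs jumps of size $j_i$ with positive rate $\lambda_{j_i}=\lambda^{(i)}_{j_i}$, $j_i=1,\dots,k_i$. Let $\hat M^q(t)=M(M_1(M_2(\dots(M_q(t))\dots)))$, $t\ge0$. Then, for $|u|\le1$, the probability generating function $\hat G^q(u,t)=\mathbb{E}(u^{\hat M^q(t)})$ is given by $$\hat G^q(u,t)=\exp\Big(-\sum_{j_q=1}^{k_q}\lambda_{j_q}t\Big(1-\exp\Big(-j_q\sum_{j_{q-1}=1}^{k_{q-1}}\lambda_{j_{q-1}}\Big(\dots\Big(1-\exp\Big(-j_1\sum_{j=1}^{k}\lambda_j(1-u^j)\Big)\Big)\dots\Big)\Big)\Big)\Big),$$ that is, $\hat G^q(u,t)=\exp(-t\,\psi_q(u))$, where $\psi_0(u)=\sum_{j=1}^{k}\lambda_j(1-u^j)$ and $\psi_i(u)=\sum_{j_i=1}^{k_i}\lambda^{(i)}_{j_i}\big(1-\exp(-j_i\psi_{i-1}(u))\big)$ for $i=1,\dots,q$.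
   Context: A generalized counting process (GCP) $\{M(t)\}_{t\ge0}$ with positive rates $\lambda_1,\dots,\lambda_k$ (jumps of size $j$ occurring at rate $\lambda_j$) is a right-continuous $\mathbb{N}_0$-valued process with $M(0)=0$ and stationary independent increments, whose probability generating function is $\mathbb{E}(u^{M(t)})=\exp\big(-t\sum_{j=1}^{k}\lambda_j(1-u^j)\big)$, $|u|\le1$. The process $\hat M^q$ is called the $q$-iterated GCP. *)

theory Defs
  imports "HOL-Probability.Probability"
begin

definition pgf :: "'a measure \<Rightarrow> ('a \<Rightarrow> nat) \<Rightarrow> complex \<Rightarrow> complex" where
  "pgf P X u = (\<integral>\<omega>. u ^ X \<omega> \<partial>P)"

text \<open>A process is given on all of \<^typ>\<open>real\<close> but is only constrained at times \<open>t \<ge> 0\<close>.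
  Increments are taken in \<^typ>\<open>int\<close>, since subtraction on \<^typ>\<open>nat\<close> truncates.
  The path conditions are required almost surely.\<close>

locale generalized_counting_process = prob_space P
  for P :: "'a measure" +
  fixes k :: nat and rate :: "nat \<Rightarrow> real" and X :: "real \<Rightarrow> 'a \<Rightarrow> nat"
  assumes k_pos: "1 \<le> k"
    and rate_pos: "\<And>j. j \<in> {1..k} \<Longrightarrow> 0 < rate j"
    and measurable_process: "\<And>t. 0 \<le> t \<Longrightarrow> X t \<in> P \<rightarrow>\<^sub>M count_space UNIV"
    and start_zero: "AE \<omega> in P. X 0 \<omega> = 0"
    and right_continuous: "AE \<omega> in P. \<forall>t\<ge>0. ((\<lambda>s. X s \<omega>) \<longlongrightarrow> X t \<omega>) (at_right t)"
    and stationary_increments: "\<And>s t. 0 \<le> s \<Longrightarrow> 0 \<le> t \<Longrightarrow>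
      distr P (count_space UNIV) (\<lambda>\<omega>. int (X (s + t) \<omega>) - int (X s \<omega>)) =
      distr P (count_space UNIV) (\<lambda>\<omega>. int (X t \<omega>) - int (X 0 \<omega>))"
    and independent_increments: "\<And>n (\<tau> :: nat \<Rightarrow> real).
      0 \<le> \<tau> 0 \<Longrightarrow> (\<And>i. i < n \<Longrightarrow> \<tau> i \<le> \<tau> (Suc i)) \<Longrightarrow>
      indep_vars (\<lambda>_. count_space UNIV)
        (\<lambda>i \<omega>. int (X (\<tau> (Suc i)) \<omega>) - int (X (\<tau> i) \<omega>)) {..<n}"
    and pgf_process: "\<And>t u. 0 \<le> t \<Longrightarrow> norm u \<le> 1 \<Longrightarrow>
      pgf P (X t) u = exp (- of_real t * (\<Sum>j=1..k. of_real (rate j) * (1 - u ^ j)))"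

text \<open>Independence of whole processes, i.e. of the path-valued random variables with respect to
  the product (cylinder) sigma-algebra.\<close>

definition independent_processes ::
    "'a measure \<Rightarrow> (nat \<Rightarrow> real \<Rightarrow> 'a \<Rightarrow> nat) \<Rightarrow> nat set \<Rightarrow> bool" where
  "independent_processes P M I \<longleftrightarrow>
     prob_space.indep_vars P (\<lambda>_. PiM {0..} (\<lambda>_. count_space UNIV))
       (\<lambda>i \<omega>. \<lambda>t\<in>{0..}. M i t \<omega>) I"

text \<open>\<open>M 0\<close> is the outermost process \<open>M\<close>, and \<open>M i\<close> for \<open>i \<ge> 1\<close> is \<open>M\<^sub>i\<close>, so that
  \<open>iterated_process M q t = M(M\<^sub>1(\<dots>(M\<^sub>q(t))\<dots>))\<close>.\<close>

primrec iterated_process ::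
    "(nat \<Rightarrow> real \<Rightarrow> 'a \<Rightarrow> nat) \<Rightarrow> nat \<Rightarrow> real \<Rightarrow> 'a \<Rightarrow> nat" where
  "iterated_process M 0 t \<omega> = M 0 t \<omega>"
| "iterated_process M (Suc i) t \<omega> = iterated_process M i (real (M (Suc i) t \<omega>)) \<omega>"

primrec iterated_exponent ::
    "(nat \<Rightarrow> nat) \<Rightarrow> (nat \<Rightarrow> nat \<Rightarrow> real) \<Rightarrow> nat \<Rightarrow> complex \<Rightarrow> complex" where
  "iterated_exponent k rate 0 u = (\<Sum>j=1..k 0. of_real (rate 0 j) * (1 - u ^ j))"
| "iterated_exponent k rate (Suc i) u =
     (\<Sum>j=1..k (Suc i). of_real (rate (Suc i) j) *
        (1 - exp (- of_nat j * iterated_exponent k rate i u)))"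

end

theory Submission imports Defs begin

text \<open>Conditioning on the value \<open>n\<close> of the inner process \<open>N = M\<^sub>i\<^sub>+\<^sub>1(t)\<close>, which is independent
  of \<open>Z n = M(M\<^sub>1(\<dots>M\<^sub>i(n)\<dots>))\<close>, turns the generating function \<open>v ^ n\<close> of \<open>Z n\<close>, where
  \<open>v = exp (- \<psi>\<^sub>i(u))\<close>, into the generating function of \<open>N\<close> evaluated at \<open>v\<close>.\<close>

context prob_space
begin

lemma integrable_power_nat:
  fixes u :: complex
  assumes [measurable]: "X \<in> M \<rightarrow>\<^sub>M count_space UNIV" and "norm u \<le> 1"
  shows "integrable M (\<lambda>\<omega>. u ^ (X \<omega> :: nat))"
  by (rule integrable_const_bound[where B = 1])
    (use assms(2) in \<open>auto simp: norm_power power_le_one\<close>)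

text \<open>This keeps the argument \<open>v\<close> of the next generating function inside the
  closed unit disc, where formula \<open>pgf_process\<close> is available.\<close>

lemma norm_pgf_le_1:
  assumes "X \<in> M \<rightarrow>\<^sub>M count_space UNIV" "norm u \<le> 1"
  shows "norm (pgf M X u) \<le> 1"
proof -
  have "norm (pgf M X u) \<le> (\<integral>\<omega>. norm (u ^ X \<omega>) \<partial>M)"
    unfolding pgf_def by (rule integral_norm_bound)
  also have "\<dots> \<le> (\<integral>\<omega>. 1 \<partial>M)"
    using assms integrable_power_nat[OF assms]
    by (intro integral_mono integrable_norm) (auto simp: norm_power power_le_one)
  finally show ?thesis by (simp add: prob_space)
qed

text \<open>Since \<open>N\<close> takes countably many values, the events \<open>N = n\<close>
  split the integral, and on each of them the random index is the constant \<open>n\<close>.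
  Independence of \<open>N\<close> from each single \<open>Z n\<close> then suffices.\<close>

lemma pgf_compose_indep:
  assumes N [measurable]: "N \<in> M \<rightarrow>\<^sub>M count_space UNIV"
    and Z [measurable]: "\<And>n. Z n \<in> M \<rightarrow>\<^sub>M count_space UNIV"
    and indep: "\<And>n. indep_var (count_space UNIV) N (count_space UNIV) (Z n)"
    and u: "norm u \<le> 1" and v: "\<And>n. pgf M (Z n) u = v ^ n"
  shows "pgf M (\<lambda>\<omega>. Z (N \<omega>) \<omega>) u = pgf M N v"
proof -
  define A where "A n = {\<omega> \<in> space M. N \<omega> = n}" for n
  have A [measurable]: "A n \<in> sets M" for n
    unfolding A_def by measurable
  have A_disj: "m \<noteq> n \<Longrightarrow> A m \<inter> A n = {}" for m n
    by (auto simp: A_def)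
  have A_UN: "(\<Union>n. A n) = space M"
    by (auto simp: A_def)
  \<comment> \<open>\<open>v\<close> is itself a generating function value, that of
    \<open>Z 1\<close>.\<close>
  have v_le: "norm v \<le> 1"
    using norm_pgf_le_1[OF Z[of 1] u] v[of 1] by simp
  have [measurable]: "(\<lambda>\<omega>. Z (N \<omega>) \<omega>) \<in> M \<rightarrow>\<^sub>M count_space UNIV"
    by (rule measurable_compose_countable'[where I = UNIV]) (use N in auto)
  have decomp: "(\<integral>\<omega>. f \<omega> \<partial>M) = (\<Sum>n. LINT \<omega>:A n|M. f \<omega>)"
    if "integrable M f" for f :: "'a \<Rightarrow> complex"
  proof -
    have "set_integrable M (\<Union>n. A n) f"
      unfolding A_UN set_integrable_def using integrable_mult_indicator[OF _ that] by auto
    from lebesgue_integral_countable_add[OF A A_disj this] show ?thesis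
      by (simp add: A_UN set_integral_space[OF that])
  qed
  have "(LINT \<omega>:A n|M. u ^ Z (N \<omega>) \<omega>) = (LINT \<omega>:A n|M. v ^ N \<omega>)" for n
  proof -
    \<comment> \<open>The indicator of \<open>A n\<close> is written as a function of
      \<open>N\<close>, so that the integrand becomes a product of functions of the independent
      variables \<open>N\<close> and \<open>Z n\<close>.\<close>
    let ?I = "\<lambda>m. if m = n then 1 else 0 :: complex"
    have ind: "indep_var borel (?I \<circ> N) borel ((\<lambda>m. u ^ m) \<circ> Z n)"
      by (rule indep_var_compose[OF indep]) auto
    have I_int: "integrable M (?I \<circ> N)"
      by (rule integrable_const_bound[where B = 1]) (auto simp: o_def)
    have u_int: "integrable M ((\<lambda>m. u ^ m) \<circ> Z n)"
      using integrable_power_nat[OF Z u] by (simp add: o_def)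
    have "(LINT \<omega>:A n|M. u ^ Z (N \<omega>) \<omega>) = (\<integral>\<omega>. ?I (N \<omega>) * u ^ Z n \<omega> \<partial>M)"
      unfolding set_lebesgue_integral_def
      by (rule Bochner_Integration.integral_cong) (auto simp: A_def indicator_def)
    also have "\<dots> = (\<integral>\<omega>. ?I (N \<omega>) \<partial>M) * v ^ n"
      using indep_var_lebesgue_integral[OF ind I_int u_int] v[of n] by (simp add: pgf_def o_def)
    also have "\<dots> = (\<integral>\<omega>. ?I (N \<omega>) * v ^ n \<partial>M)"
      by simp
    also have "\<dots> = (LINT \<omega>:A n|M. v ^ N \<omega>)"
      unfolding set_lebesgue_integral_def
      by (rule Bochner_Integration.integral_cong) (auto simp: A_def indicator_def)
    finally show ?thesis .
  qed
  then show ?thesis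
    unfolding pgf_def
    by (simp add: decomp[OF integrable_power_nat] u v_le)
qed

end

text \<open>The iterated process depends on \<omega> only through the paths on \<open>{0..}\<close>
  with indices up to \<open>i\<close>: evaluating the coordinate process at these paths recovers it.
  Inner times are natural numbers, so they stay in \<open>{0..}\<close>.\<close>

lemma iterated_process_restrict:
  assumes "{0..i} \<subseteq> I" "0 \<le> t"
  shows "iterated_process (\<lambda>i t f. f i t) i t (\<lambda>i\<in>I. \<lambda>s\<in>{0..}. M i s \<omega>) =
    iterated_process M i t \<omega>"
  using assms
proof (induction i arbitrary: t)
  case (Suc i)
  then have "{0..i} \<subseteq> I" "Suc i \<in> I" by auto
  with Suc show ?case by simp
qed auto

text \<open>The random time is a natural number, so measurability at each fixed time is enough for
  the composition.\<close>

lemma measurable_iterated_process: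
  assumes "\<And>i t. i \<le> n \<Longrightarrow> 0 \<le> t \<Longrightarrow> M i t \<in> N \<rightarrow>\<^sub>M count_space UNIV" "0 \<le> t"
  shows "iterated_process M n t \<in> N \<rightarrow>\<^sub>M count_space UNIV"
  using assms
proof (induction n arbitrary: t)
  case 0
  moreover have "iterated_process M 0 t = M 0 t" by auto
  ultimately show ?case by simp
next
  case (Suc n)
  have eq: "iterated_process M (Suc n) t = (\<lambda>\<omega>. iterated_process M n (real (M (Suc n) t \<omega>)) \<omega>)"
    by auto
  show ?case
    unfolding eq
    by (rule measurable_compose_countable'[where I = UNIV
          and f = "\<lambda>m. iterated_process M n (real m)"])
      (use Suc in auto)
qed

text \<open>The two variables are measurable functionals of the path families over the disjoint
  index sets \<open>{Suc i}\<close> and \<open>{0..i}\<close>.\<close>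

lemma (in prob_space) indep_var_iterated_process:
  assumes indep: "independent_processes M X {0..q}" and i: "Suc i \<le> q" and t: "0 \<le> s" "0 \<le> t"
  shows "indep_var (count_space UNIV) (X (Suc i) s) (count_space UNIV) (iterated_process X i t)"
proof -
  let ?S = "PiM {0..} (\<lambda>_. count_space UNIV) :: (real \<Rightarrow> nat) measure"
  let ?path = "\<lambda>i \<omega>. \<lambda>t\<in>{0..}. X i t \<omega>"
  have eval: "(\<lambda>f. f j r) \<in> PiM J (\<lambda>_. ?S) \<rightarrow>\<^sub>M count_space UNIV"
    if "j \<in> J" "0 \<le> r" for j J and r :: real
  proof (rule measurable_compose[where f = "\<lambda>f. f j" and g = "\<lambda>p. p r"])
    show "(\<lambda>f. f j) \<in> PiM J (\<lambda>_. ?S) \<rightarrow>\<^sub>M ?S"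
      using that by (intro measurable_component_singleton)
    show "(\<lambda>p. p r) \<in> ?S \<rightarrow>\<^sub>M count_space UNIV"
      using that by (intro measurable_component_singleton) auto
  qed
  have "indep_var (PiM {Suc i} (\<lambda>_. ?S)) (\<lambda>\<omega>. restrict (\<lambda>j. ?path j \<omega>) {Suc i})
      (PiM {0..i} (\<lambda>_. ?S)) (\<lambda>\<omega>. restrict (\<lambda>j. ?path j \<omega>) {0..i})"
    using indep i unfolding independent_processes_def
    by (intro indep_var_restrict[where I = "{0..q}"]) auto
  moreover have "(\<lambda>f. f (Suc i) s) \<in> PiM {Suc i} (\<lambda>_. ?S) \<rightarrow>\<^sub>M count_space UNIV"
    using t by (intro eval) auto
  moreover have "iterated_process (\<lambda>i t f. f i t) i t
      \<in> PiM {0..i} (\<lambda>_. ?S) \<rightarrow>\<^sub>M count_space UNIV"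
    using t by (intro measurable_iterated_process eval) auto
  ultimately have "indep_var (count_space UNIV)
      ((\<lambda>f. f (Suc i) s) \<circ> (\<lambda>\<omega>. restrict (\<lambda>j. ?path j \<omega>) {Suc i})) (count_space UNIV)
      (iterated_process (\<lambda>i t f. f i t) i t \<circ> (\<lambda>\<omega>. restrict (\<lambda>j. ?path j \<omega>) {0..i}))"
    by (rule indep_var_compose)
  then show ?thesis
    using t by (simp add: o_def iterated_process_restrict)
qed

theorem proposition4p8:
  fixes P :: "'a measure"
    and M :: "nat \<Rightarrow> real \<Rightarrow> 'a \<Rightarrow> nat"
    and k :: "nat \<Rightarrow> nat"
    and rate :: "nat \<Rightarrow> nat \<Rightarrow> real"
    and q :: nat and t :: real and u :: complex
  assumes "1 \<le> q"
    and "\<And>i. i \<le> q \<Longrightarrow> generalized_counting_process P (k i) (rate i) (M i)"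
    and "independent_processes P M {0..q}"
    and "0 \<le> t" and "norm u \<le> 1"
  shows "pgf P (iterated_process M q t) u = exp (- of_real t * iterated_exponent k rate q u)"
proof -
  interpret prob_space P
    using assms(2)[of 0] by (simp add: generalized_counting_process_def)
  note gcp = assms(2)
  have meas: "M i s \<in> P \<rightarrow>\<^sub>M count_space UNIV" if "i \<le> q" "0 \<le> s" for i s
    by (rule generalized_counting_process.measurable_process[OF gcp]) (use that in auto)
  have meas_iter: "iterated_process M i s \<in> P \<rightarrow>\<^sub>M count_space UNIV" if "i \<le> q" "0 \<le> s" for i s
    using that by (intro measurable_iterated_process meas) auto
  \<comment> \<open>The time \<open>s\<close> is generalized because the induction hypothesis is
    applied at the integer values of the next inner process.\<close>
  have "pgf P (iterated_process M i s) u = exp (- of_real s * iterated_exponent k rate i u)"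
    if "i \<le> q" "0 \<le> s" for i s
    using that
  proof (induction i arbitrary: s)
    case 0
    have "iterated_process M 0 s = M 0 s" by auto
    then show ?case
      using generalized_counting_process.pgf_process[OF gcp[of 0], of s u] 0 assms(5) by simp
  next
    case (Suc i)
    define v where "v = exp (- iterated_exponent k rate i u)"
    have iter: "pgf P (iterated_process M i (real n)) u = v ^ n" for n
      using Suc by (simp add: v_def flip: exp_of_nat_mult)
    \<comment> \<open>Here \<open>v\<close> is the generating function of the \<open>i\<close>-fold
      iterate at time 1; this replaces a direct proof that the exponent has nonnegative real
      part.\<close>
    have v: "norm v \<le> 1"
      using norm_pgf_le_1[OF meas_iter[of i 1] assms(5)] iter[of 1] Suc.prems by simp
    have "pgf P (iterated_process M (Suc i) s) u =
        pgf P (\<lambda>\<omega>. iterated_process M i (real (M (Suc i) s \<omega>)) \<omega>) u"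
      by (simp add: pgf_def)
    also have "\<dots> = pgf P (M (Suc i) s) v"
      using Suc.prems assms(3,5)
      by (intro pgf_compose_indep meas meas_iter iter indep_var_iterated_process) auto
    \<comment> \<open>With \<open>v ^ j = exp (- j * \<psi>)\<close> for the exponent \<psi> of
      level \<open>i\<close>, the sum in \<open>pgf_process\<close> becomes the recursion for
      \<open>iterated_exponent\<close>.\<close>
    also have "\<dots> = exp (- of_real s * iterated_exponent k rate (Suc i) u)"
      using generalized_counting_process.pgf_process[OF gcp[OF Suc.prems(1)] Suc.prems(2) v]
      by (simp add: v_def flip: exp_of_nat_mult)
    finally show ?case .
  qed
  with assms(4) show ?thesis by simp
qed

end
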